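(* Let $G$ be a finite group, let $H$ be a normal subgroup of $G$, and let $a$ and $b$ be two distinct vertices of the normal subgroup based power graph $\Gamma_H(G)$. Then $a$ is adjacent to $b$ in $\Gamma_H(G)$ if and only if either $aH=bH$ or $aH$ is adjacent to $bH$ in the power graph $\Gamma(G/H)$.
   Context: For a finite group $G$ with identity $e$ and a normal subgroup $H$ of $G$, the normal subgroup based power graph $\Gamma_H(G)$ is the simple undirected graph with vertex set $V(\Gamma_H(G))=(G\setminus H)\cup\{e\}$, in which two distinct vertices $x,y$ are adjacent if and only if $xH=y^mH$ or $yH=x^nH$ for some $m,n\in\mathbb{N}$. Here $\mathbb{N}$ denotes the positive integers. For a finite group $K$, the (undirected) power graph $\Gamma(K)$ is the simple graph with vertex set $K$ in which two distinct elements $u,v$ are adjacent if and only if $u=v^m$ or $v=u^m$ for some positive integer $m$. *)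

theory Defs
  imports "HOL-Algebra.Coset" "Graph_Theory.Pair_Digraph"
begin

text \<open>
  A simple undirected graph is a symmetric loop-free digraph without parallel arcs, as in
  the locale \<^locale>\<open>pair_graph\<close>; adjacency of \<open>u\<close> and \<open>v\<close> is then the relation
  \<open>u \<rightarrow>\<^bsub>\<Gamma>\<^esub> v\<close>. The natural numbers in the definitions below are positive, hence the
  explicit conditions on the exponents.
\<close>

definition power_graph :: "('a, 'm) monoid_scheme \<Rightarrow> 'a pair_pre_digraph" where
  "power_graph K =
    \<lparr> pverts = carrier K,
      parcs = {(u, v). u \<in> carrier K \<and> v \<in> carrier K \<and> u \<noteq> v \<and>
        ((\<exists>m::nat. m > 0 \<and> u = v [^]\<^bsub>K\<^esub> m) \<or> (\<exists>m::nat. m > 0 \<and> v = u [^]\<^bsub>K\<^esub> m))} \<rparr>"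

definition nsb_verts :: "('a, 'm) monoid_scheme \<Rightarrow> 'a set \<Rightarrow> 'a set" where
  "nsb_verts G H = (carrier G - H) \<union> {\<one>\<^bsub>G\<^esub>}"

definition nsb_power_graph :: "('a, 'm) monoid_scheme \<Rightarrow> 'a set \<Rightarrow> 'a pair_pre_digraph" where
  "nsb_power_graph G H =
    \<lparr> pverts = nsb_verts G H,
      parcs = {(x, y). x \<in> nsb_verts G H \<and> y \<in> nsb_verts G H \<and> x \<noteq> y \<and>
        ((\<exists>m::nat. m > 0 \<and> x <#\<^bsub>G\<^esub> H = (y [^]\<^bsub>G\<^esub> m) <#\<^bsub>G\<^esub> H) \<or>
         (\<exists>n::nat. n > 0 \<and> y <#\<^bsub>G\<^esub> H = (x [^]\<^bsub>G\<^esub> n) <#\<^bsub>G\<^esub> H))} \<rparr>"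

lemma pair_graph_power_graph:
  assumes "finite (carrier K)"
  shows "pair_graph (power_graph K)"
proof -
  have "finite (parcs (power_graph K))"
    by (rule finite_subset[of _ "carrier K \<times> carrier K"])
      (use assms in \<open>auto simp: power_graph_def\<close>)
  then show ?thesis
    using assms by unfold_locales (auto simp: power_graph_def symmetric_def sym_def)
qed

lemma pair_graph_nsb_power_graph:
  assumes "finite (carrier G)"
  shows "pair_graph (nsb_power_graph G H)"
proof -
  have fin: "finite (nsb_verts G H)"
    using assms by (simp add: nsb_verts_def)
  have "finite (parcs (nsb_power_graph G H))"
    by (rule finite_subset[of _ "nsb_verts G H \<times> nsb_verts G H"])
      (use fin in \<open>auto simp: nsb_power_graph_def\<close>)
  then show ?thesis
    using fin by unfold_locales (auto simp: nsb_power_graph_def symmetric_def sym_def)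
qed

end

theory Submission
  imports Defs
begin

text \<open>The projection of \<open>G\<close> onto \<open>G Mod H\<close> is a homomorphism, so the
  coset of a power is the power of the coset (\<open>l_coset_nat_pow_Mod\<close>). Adjacency of
  distinct vertices in \<open>nsb_power_graph G H\<close> therefore says that one of their cosets is
  a positive power of the other. \<open>power_graph (G Mod H)\<close> requires in addition that the
  cosets differ; the alternative of equal cosets makes up for this.\<close>

lemma (in normal) l_coset_nat_pow_Mod:
  assumes "x \<in> carrier G"
  shows "(x <# H) [^]\<^bsub>G Mod H\<^esub> (n::nat) = (x [^] n) <# H"
  using FactGroup_pow[OF assms, of n] coset_eq assms by simp

theorem proposition2p6:
  fixes G :: "('a, 'm) monoid_scheme" and H :: "'a set" and a b :: 'a
  assumes "group G" and "finite (carrier G)" and "H \<lhd> G"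
    and "a \<in> pverts (nsb_power_graph G H)" and "b \<in> pverts (nsb_power_graph G H)"
    and "a \<noteq> b"
  shows "a \<rightarrow>\<^bsub>nsb_power_graph G H\<^esub> b \<longleftrightarrow>
    (a <#\<^bsub>G\<^esub> H = b <#\<^bsub>G\<^esub> H \<or>
     (a <#\<^bsub>G\<^esub> H) \<rightarrow>\<^bsub>power_graph (G Mod H)\<^esub> (b <#\<^bsub>G\<^esub> H))"
proof -
  interpret normal H G by (fact assms(3))
  have verts: "a \<in> nsb_verts G H" "b \<in> nsb_verts G H"
    using assms(4,5) by (simp_all add: nsb_power_graph_def)
  then have a: "a \<in> carrier G" and b: "b \<in> carrier G"
    by (auto simp: nsb_verts_def)
  \<comment> \<open>The carrier of \<open>G Mod H\<close> consists of right cosets; normality,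
    through \<open>coset_eq\<close>, identifies them with left cosets.\<close>
  have cosets: "a <#\<^bsub>G\<^esub> H \<in> carrier (G Mod H)" "b <#\<^bsub>G\<^esub> H \<in> carrier (G Mod H)"
    using a b coset_eq by (auto simp: FactGroup_def RCOSETS_def)
  \<comment> \<open>Exponent 1: distinct vertices in the same coset are adjacent, although their
    common coset carries no loop in the power graph.\<close>
  have refl: "\<exists>m::nat. m > 0 \<and> a <#\<^bsub>G\<^esub> H = (b [^]\<^bsub>G\<^esub> m) <#\<^bsub>G\<^esub> H" if "a <#\<^bsub>G\<^esub> H = b <#\<^bsub>G\<^esub> H"
    using that b by (intro exI[of _ 1]) simp
  have "a \<rightarrow>\<^bsub>nsb_power_graph G H\<^esub> b \<longleftrightarrow>
      (\<exists>m::nat. m > 0 \<and> a <#\<^bsub>G\<^esub> H = (b [^]\<^bsub>G\<^esub> m) <#\<^bsub>G\<^esub> H) \<or> (\<exists>n::nat. n > 0 \<and> b <#\<^bsub>G\<^esub> H = (a [^]\<^bsub>G\<^esub> n) <#\<^bsub>G\<^esub> H)"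
    using verts assms(6) by (simp add: nsb_power_graph_def)
  \<comment> \<open>Once powers of cosets become cosets of powers, this is the previous disjunction
    with the extra conjunct that the cosets differ.\<close>
  moreover have "(a <#\<^bsub>G\<^esub> H) \<rightarrow>\<^bsub>power_graph (G Mod H)\<^esub> (b <#\<^bsub>G\<^esub> H) \<longleftrightarrow> a <#\<^bsub>G\<^esub> H \<noteq> b <#\<^bsub>G\<^esub> H \<and>
      ((\<exists>m::nat. m > 0 \<and> a <#\<^bsub>G\<^esub> H = (b [^]\<^bsub>G\<^esub> m) <#\<^bsub>G\<^esub> H) \<or> (\<exists>n::nat. n > 0 \<and> b <#\<^bsub>G\<^esub> H = (a [^]\<^bsub>G\<^esub> n) <#\<^bsub>G\<^esub> H))"
    using cosets by (simp add: power_graph_def l_coset_nat_pow_Mod a b)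
  ultimately show ?thesis
    using refl by blast
qed

end
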